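(* Let $\mathcal{I}$ be a ground set of $n\ge 2$ elements, $\mathcal{S}$ a family of $m$ subsets of $\mathcal{I}$ covering $\mathcal{I}$, and $\theta>1$. The degradation factor of the online set cover algorithm $\mathrm{OSC\text{-}Alg}(\theta)$ with respect to the baseline $\mathrm{OSC\text{-}Alg}(2)$, whose competitive ratio is $4\log n\,(2+\log m)$, is $$\mathrm{DF}(\mathrm{OSC\text{-}Alg}(\theta))=\theta\left[\frac{2\log\theta+\log m}{2\log\theta\,(2+\log m)}\right],$$ i.e. $\mathrm{OSC\text{-}Alg}(\theta)$ has competitive ratio $$\mathrm{DF}(\mathrm{OSC\text{-}Alg}(\theta))\cdot 4\log n\,(2+\log m)=(2\theta\log n)\left(2+\frac{\log m}{\log\theta}\right):$$ for every sequence of arriving elements, the number of sets it selects is at most this quantity times the minimum number of sets of $\mathcal{S}$ needed to cover the arrived elements.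
   Context: All logarithms are to base $2$. Online (unweighted) set cover: $\mathcal{I}$ and $\mathcal{S}$ are known in advance. The elements of an unknown subset $\mathcal{I}'\subseteq\mathcal{I}$ arrive one by one. When an element arrives it must be covered by the sets selected so far, where selections are irrevocable. The goal is to minimize the number of selected sets. The offline optimum is the minimum number of sets in $\mathcal{S}$ covering $\mathcal{I}'$. For $i\in\mathcal{I}$ let $\mathcal{S}_i=\{s\in\mathcal{S}: i\in s\}$. The algorithm maintains set weights $w_s$, and element weights $w_i=\sum_{s\in\mathcal{S}_i}w_s$. It also maintains the collection $\mathcal{S}^{\mathrm{sel}}$ of selected sets, the set $\mathcal{I}^{\mathrm{sel}}$ of covered elements (those belonging to some selected set), and the potential $\Phi=\sum_{i\notin\mathcal{I}^{\mathrm{sel}}}n^{2w_i}$. $\mathrm{OSC\text{-}Alg}(\theta)$, $\theta>1$: initialize $w_s=\frac{1}{\theta m}$ for all $s\in\mathcal{S}$ and $\mathcal{I}^{\mathrm{sel}}=\mathcal{S}^{\mathrm{sel}}=\emptyset$. When element $i$ arrives: - if $w_i\ge1$, i.e. $i$ is already covered ($i\in\mathcal{I}^{\mathrm{sel}}$), do nothing; - otherwise (a) find the minimum $k$ such that $\theta^k w_i>1$; (b) update $w_s\leftarrow\theta^k w_s$ for all $s\in\mathcal{S}_i$; (c) select at most $2\theta\log n$ sets from $\mathcal{S}_i$ such that, after adding them to $\mathcal{S}^{\mathrm{sel}}$ (with the updated weights), the potential $\Phi$ is not larger than it was before this step, and add $i$ to $\mathcal{I}^{\mathrm{sel}}$.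 For $\theta=2$ this is the known algorithm, with competitive ratio $4\log n\,(2+\log m)$. The degradation factor $\mathrm{DF}(A(\theta))$ relative to a baseline $A(\theta_0)$ is a factor with $\mathrm{CR}(A(\theta))\le\mathrm{DF}(A(\theta))\,\mathrm{CR}(A(\theta_0))$.
   Formalization: For 1<θ<2 an element with w_i≥1 need not be covered, so the algorithm as described may leave arrived elements uncovered; here it skips whenever w_i≥1, the bound on the number of selected sets is stated for all θ>1, and coverage of all arrived elements only for θ≥2. *)

theory Defs
  imports Complex_Main
begin

definition sets_of :: "'a set set \<Rightarrow> 'a \<Rightarrow> 'a set set"
  where "sets_of S i = {s \<in> S. i \<in> s}"

record 'a osc_state =
  wt :: "'a set \<Rightarrow> real"
  sel :: "'a set set"

definition covered :: "'a osc_state \<Rightarrow> 'a set"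
  where "covered st = \<Union> (sel st)"

definition elem_wt :: "'a set set \<Rightarrow> 'a osc_state \<Rightarrow> 'a \<Rightarrow> real"
  where "elem_wt S st i = (\<Sum>s\<in>sets_of S i. wt st s)"

definition potential :: "'a set \<Rightarrow> 'a set set \<Rightarrow> 'a osc_state \<Rightarrow> real"
  where "potential I S st = (\<Sum>i\<in>I - covered st. real (card I) powr (2 * elem_wt S st i))"

definition osc_init :: "real \<Rightarrow> 'a set set \<Rightarrow> 'a osc_state"
  where "osc_init \<theta> S = \<lparr>wt = (\<lambda>s. 1 / (\<theta> * real (card S))), sel = {}\<rparr>"

definition osc_exponent :: "real \<Rightarrow> 'a set set \<Rightarrow> 'a osc_state \<Rightarrow> 'a \<Rightarrow> nat"
  where "osc_exponent \<theta> S st i = (LEAST k. \<theta> ^ k * elem_wt S st i > 1)"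

definition osc_update :: "real \<Rightarrow> 'a set set \<Rightarrow> 'a osc_state \<Rightarrow> 'a \<Rightarrow> 'a set set \<Rightarrow> 'a osc_state"
  where "osc_update \<theta> S st i T =
    \<lparr>wt = (\<lambda>s. if s \<in> sets_of S i then \<theta> ^ osc_exponent \<theta> S st i * wt st s else wt st s),
     sel = sel st \<union> T\<rparr>"

definition osc_admissible ::
  "real \<Rightarrow> 'a set \<Rightarrow> 'a set set \<Rightarrow> 'a osc_state \<Rightarrow> 'a \<Rightarrow> 'a set set \<Rightarrow> bool"
  where "osc_admissible \<theta> I S st i T \<longleftrightarrow>
    T \<subseteq> sets_of S i \<and>
    real (card T) \<le> 2 * \<theta> * log 2 (real (card I)) \<and>
    potential I S (osc_update \<theta> S st i T) \<le> potential I S st \<and>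
    i \<in> covered (osc_update \<theta> S st i T)"

(* The algorithm does not fix which admissible sets are selected, so it is a relation between
   states.  An element of weight below 1 may already be covered by a set selected for another
   element; the relation allows both doing nothing and augmenting in that case, so statements
   about all runs hold whether the test is read as "weight at least 1" or as "weight at least 1
   or covered". *)
inductive osc_step ::
  "real \<Rightarrow> 'a set \<Rightarrow> 'a set set \<Rightarrow> 'a osc_state \<Rightarrow> 'a \<Rightarrow> 'a osc_state \<Rightarrow> bool"
  for \<theta> :: real and I :: "'a set" and S :: "'a set set"
  where
    skip: "elem_wt S st i \<ge> 1 \<or> i \<in> covered st \<Longrightarrow> osc_step \<theta> I S st i st"
  | augment: "elem_wt S st i < 1 \<Longrightarrow> osc_admissible \<theta> I S st i T \<Longrightarrow>
      osc_step \<theta> I S st i (osc_update \<theta> S st i T)"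

inductive osc_run ::
  "real \<Rightarrow> 'a set \<Rightarrow> 'a set set \<Rightarrow> 'a list \<Rightarrow> 'a osc_state \<Rightarrow> bool"
  for \<theta> :: real and I :: "'a set" and S :: "'a set set"
  where
    start: "osc_run \<theta> I S [] (osc_init \<theta> S)"
  | arrive: "osc_run \<theta> I S \<sigma> st \<Longrightarrow> i \<in> I \<Longrightarrow> osc_step \<theta> I S st i st' \<Longrightarrow>
      osc_run \<theta> I S (\<sigma> @ [i]) st'"

definition opt_cover :: "'a set set \<Rightarrow> 'a set \<Rightarrow> nat"
  where "opt_cover S X = Min (card ` {C. C \<subseteq> S \<and> X \<subseteq> \<Union> C})"

definition osc_competitive :: "'a set \<Rightarrow> 'a set set \<Rightarrow> real \<Rightarrow> real \<Rightarrow> bool"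
  where "osc_competitive I S \<theta> c \<longleftrightarrow>
    (\<forall>\<sigma> st. osc_run \<theta> I S \<sigma> st \<longrightarrow> real (card (sel st)) \<le> c * real (opt_cover S (set \<sigma>)))"

(* Competitive ratios are guarantees (upper bounds), as usual in competitive analysis: d is a
   degradation factor relative to the baseline parameter \<theta>0 with ratio c0 if d * c0 is a
   competitive ratio for \<theta>. *)
definition osc_degradation_factor ::
  "'a set \<Rightarrow> 'a set set \<Rightarrow> real \<Rightarrow> real \<Rightarrow> real \<Rightarrow> real \<Rightarrow> bool"
  where "osc_degradation_factor I S \<theta>0 c0 \<theta> d \<longleftrightarrow>
    osc_competitive I S \<theta>0 c0 \<and> osc_competitive I S \<theta> (d * c0)"

(* Non-vacuity of statements about all runs: the required selection always exists. *)
definition osc_never_stuck :: "'a set \<Rightarrow> 'a set set \<Rightarrow> real \<Rightarrow> bool"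
  where "osc_never_stuck I S \<theta> \<longleftrightarrow>
    (\<forall>\<sigma> st i. osc_run \<theta> I S \<sigma> st \<and> i \<in> I \<and> elem_wt S st i < 1 \<longrightarrow>
      (\<exists>T. osc_admissible \<theta> I S st i T))"

(* Runs are closed under prefixes, so this says that each element is covered from its arrival
   on.  For 1 < \<theta> < 2 it can fail: the initial potential may exceed n^2, and then
   weight at least 1 does not imply being covered. *)
definition osc_covers :: "'a set \<Rightarrow> 'a set set \<Rightarrow> real \<Rightarrow> bool"
  where "osc_covers I S \<theta> \<longleftrightarrow>
    (\<forall>\<sigma> st. osc_run \<theta> I S \<sigma> st \<longrightarrow> set \<sigma> \<subseteq> covered st)"

end

(* Competitiveness: an augmentation for i multiplies the weight of every set containing i by at
   least \<theta> and leaves it at most \<theta>, because w_i is at most \<theta> afterwards.  Since weights start at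
   1 / (\<theta> m), each set of a cover C can be charged for at most 2 + log m / log \<theta> augmentations,
   and each augmentation involves a set of C.

   Never stuck: draw N sets of S_i independently, s with probability w_s / w_i.  An element j whose
   weight grows by d stays uncovered with probability at most exp (- N d / \<theta>), which is at most
   n powr (- 2 d) if N \<ge> 2 \<theta> ln n, so the expected potential does not grow.  An integer N between
   2 \<theta> ln n and 2 \<theta> log 2 n exists for n \<ge> 4; for smaller n, the n - 1 elements other than i can be
   covered one by one.

   Covering: for \<theta> \<ge> 2 the potential starts below n\<^sup>2 unless S = {I}, and an uncovered element
   of weight at least 1 would contribute n\<^sup>2. *)
theory Submission
  imports Defs
begin

section \<open>Averaging and derandomized sampling\<close>

lemma exists_le_weighted_average:
  fixes q f :: "'b \<Rightarrow> real"
  assumes "finite A" and "\<And>s. s \<in> A \<Longrightarrow> q s \<ge> 0" and "sum q A = 1"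
  shows "\<exists>s\<in>A. f s \<le> (\<Sum>s\<in>A. q s * f s)"
proof (rule ccontr)
  assume "\<not> ?thesis"
  then have less: "\<And>s. s \<in> A \<Longrightarrow> (\<Sum>s\<in>A. q s * f s) < f s"
    by force
  define c where "c = (\<Sum>s\<in>A. q s * f s)"
  \<comment> \<open>Since \<open>q\<close> sums to 1, some \<open>s0\<close> has positive mass; it
    makes the averaged inequality strict.\<close>
  obtain s0 where s0: "s0 \<in> A" "q s0 > 0"
    using assms by (metis less_eq_real_def sum.neutral zero_neq_one)
  have "(\<Sum>s\<in>A. q s * c) < (\<Sum>s\<in>A. q s * f s)"
  proof (rule sum_strict_mono_ex1[OF assms(1)])
    show "\<forall>s\<in>A. q s * c \<le> q s * f s"
      using less assms(2) unfolding c_def by (simp add: less_imp_le mult_left_mono)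
    show "\<exists>s\<in>A. q s * c < q s * f s"
      using s0 less unfolding c_def by (auto intro!: bexI[of _ s0])
  qed
  moreover have "(\<Sum>s\<in>A. q s * c) = c"
    using assms(3) by (simp add: sum_distrib_right[symmetric])
  ultimately show False
    by (simp add: c_def)
qed

text \<open>Derandomization by conditional expectations: the right-hand side is the expected weight
  left uncovered by \<open>N\<close> independent draws from \<open>q\<close>.\<close>

lemma exists_selection_le_expectation:
  fixes q :: "'b set \<Rightarrow> real" and v :: "'b \<Rightarrow> real"
  assumes "finite A" and "\<And>s. s \<in> A \<Longrightarrow> q s \<ge> 0" and "sum q A = 1" and "finite J"
  shows "\<exists>T\<subseteq>A. card T \<le> N \<and> (N > 0 \<longrightarrow> T \<noteq> {}) \<and>
    (\<Sum>j\<in>J - \<Union>T. v j) \<le> (\<Sum>j\<in>J. v j * (1 - (\<Sum>s\<in>{s\<in>A. j \<in> s}. q s)) ^ N)"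
  using assms(4)
proof (induction N arbitrary: J)
  case 0
  show ?case
    by (rule exI[of _ "{}"]) auto
next
  case (Suc N)
  \<comment> \<open>\<open>r j\<close> is the probability that a single draw misses
    \<open>j\<close>.\<close>
  define r where "r j = 1 - (\<Sum>s\<in>{s\<in>A. j \<in> s}. q s)" for j
  have r: "r j = (\<Sum>s\<in>A. if j \<in> s then 0 else q s)" for j
  proof -
    have "r j = (\<Sum>s\<in>A. q s) - (\<Sum>s\<in>A. if j \<in> s then q s else 0)"
      using assms(1,3) by (simp add: r_def sum.inter_filter)
    also have "\<dots> = (\<Sum>s\<in>A. if j \<in> s then 0 else q s)"
      by (subst sum_subtractf[symmetric], rule sum.cong) auto
    finally show ?thesis .
  qed
  \<comment> \<open>Averaging over the first draw supplies the additional factor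
    \<open>r j\<close>.\<close>
  have "(\<Sum>s\<in>A. q s * (\<Sum>j\<in>J - s. v j * r j ^ N)) =
      (\<Sum>s\<in>A. \<Sum>j\<in>J. if j \<in> s then 0 else q s * (v j * r j ^ N))"
  proof (rule sum.cong)
    fix s
    have "(\<Sum>j\<in>J - s. v j * r j ^ N) = (\<Sum>j\<in>J. if j \<in> s then 0 else v j * r j ^ N)"
      using Suc.prems by (intro sum.mono_neutral_cong_left) auto
    then show "q s * (\<Sum>j\<in>J - s. v j * r j ^ N) =
        (\<Sum>j\<in>J. if j \<in> s then 0 else q s * (v j * r j ^ N))"
      by (simp add: sum_distrib_left if_distrib cong: if_cong)
  qed simp
  also have "\<dots> = (\<Sum>j\<in>J. \<Sum>s\<in>A. if j \<in> s then 0 else q s * (v j * r j ^ N))"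
    by (rule sum.swap)
  also have "\<dots> = (\<Sum>j\<in>J. v j * r j ^ Suc N)"
  proof (rule sum.cong)
    fix j
    have "(\<Sum>s\<in>A. if j \<in> s then 0 else q s * (v j * r j ^ N)) =
        (\<Sum>s\<in>A. (if j \<in> s then 0 else q s) * (v j * r j ^ N))"
      by (rule sum.cong) auto
    also have "\<dots> = r j * (v j * r j ^ N)"
      by (simp add: r sum_distrib_right)
    finally show "(\<Sum>s\<in>A. if j \<in> s then 0 else q s * (v j * r j ^ N)) = v j * r j ^ Suc N"
      by simp
  qed simp
  \<comment> \<open>A first draw no worse than average is fixed; the induction hypothesis then
    treats the elements outside it with \<open>N\<close> draws left.\<close>
  finally obtain s where s: "s \<in> A"
    and s_le: "(\<Sum>j\<in>J - s. v j * r j ^ N) \<le> (\<Sum>j\<in>J. v j * r j ^ Suc N)"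
    using exists_le_weighted_average[OF assms(1-3), of "\<lambda>s. \<Sum>j\<in>J - s. v j * r j ^ N"] by auto
  obtain T where T: "T \<subseteq> A" "card T \<le> N"
    and T_le: "(\<Sum>j\<in>J - s - \<Union>T. v j) \<le> (\<Sum>j\<in>J - s. v j * r j ^ N)"
    using Suc.IH[of "J - s"] Suc.prems unfolding r_def by blast
  have "J - \<Union>(insert s T) = J - s - \<Union>T"
    by auto
  then have "(\<Sum>j\<in>J - \<Union>(insert s T). v j) \<le> (\<Sum>j\<in>J. v j * r j ^ Suc N)"
    using T_le s_le by simp
  moreover have "card (insert s T) \<le> Suc N"
    using T(2) card_insert_le_m1[of "Suc N" T s] by simp
  ultimately show ?case
    using s T(1) unfolding r_def by (intro exI[of _ "insert s T"]) auto
qed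

section \<open>The offline optimum\<close>

lemma opt_cover_attained:
  assumes "finite S" and "X \<subseteq> \<Union>S"
  obtains C where "C \<subseteq> S" and "X \<subseteq> \<Union>C" and "card C = opt_cover S X"
proof -
  have "finite {C. C \<subseteq> S \<and> X \<subseteq> \<Union>C}"
    using assms(1) by (rule_tac finite_subset[of _ "Pow S"]) auto
  moreover have "S \<in> {C. C \<subseteq> S \<and> X \<subseteq> \<Union>C}"
    using assms(2) by auto
  ultimately have "opt_cover S X \<in> card ` {C. C \<subseteq> S \<and> X \<subseteq> \<Union>C}"
    unfolding opt_cover_def by (intro Min_in) auto
  then show thesis
    using that by auto
qed

section \<open>The instance and the scaling exponent\<close>

locale osc =
  fixes I :: "'a set" and S :: "'a set set" and \<theta> :: real
  assumes finite_I: "finite I" and card_I: "card I \<ge> 2"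
    and S_subset: "S \<subseteq> Pow I" and Union_S: "\<Union>S = I" and theta: "\<theta> > 1"
begin

lemma finite_S: "finite S"
  using finite_I S_subset by (meson finite_Pow_iff finite_subset)

lemma card_S_pos: "card S > 0"
  using finite_S Union_S card_I by (metis Union_empty card.empty card_gt_0_iff not_numeral_le_zero)

lemma finite_sets_of: "finite (sets_of S i)"
  using finite_S by (simp add: sets_of_def)

lemma sets_of_nonempty: "i \<in> I \<Longrightarrow> sets_of S i \<noteq> {}"
  using Union_S by (auto simp: sets_of_def)

lemma elem_wt_pos:
  assumes "i \<in> I" and "\<And>s. s \<in> S \<Longrightarrow> wt st s > 0"
  shows "elem_wt S st i > 0"
  unfolding elem_wt_def
  using assms sets_of_nonempty finite_sets_of by (intro sum_pos) (auto simp: sets_of_def)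

text \<open>Powers of \<open>\<theta>\<close> are unbounded, so the least exponent exists. It is not
  0 because the weight is below 1; hence it has a predecessor, which fails the test, and one more
  factor \<open>\<theta>\<close> gives the upper bound.\<close>

lemma osc_exponent_bounds:
  assumes "elem_wt S st i > 0" and "elem_wt S st i < 1"
  shows "osc_exponent \<theta> S st i \<ge> 1"
    and "\<theta> ^ osc_exponent \<theta> S st i * elem_wt S st i > 1"
    and "\<theta> ^ osc_exponent \<theta> S st i * elem_wt S st i \<le> \<theta>"
proof -
  let ?P = "\<lambda>k. \<theta> ^ k * elem_wt S st i > 1"
  let ?k = "osc_exponent \<theta> S st i"
  obtain k where "\<theta> ^ k > 1 / elem_wt S st i"
    using real_arch_pow[OF theta] by blast
  then have "?P k"
    using assms(1) by (simp add: field_simps)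
  then show P: "?P ?k"
    unfolding osc_exponent_def by (rule LeastI)
  show ge: "?k \<ge> 1"
  proof (rule ccontr)
    assume "\<not> ?k \<ge> 1"
    then show False
      using P assms(2) by (simp add: not_less_eq_eq)
  qed
  then obtain l where l: "?k = Suc l"
    by (metis One_nat_def Suc_le_D)
  have "\<not> ?P l"
    using not_less_Least[of l ?P] l unfolding osc_exponent_def by simp
  then show "\<theta> ^ ?k * elem_wt S st i \<le> \<theta>"
    using l theta by simp
qed

section \<open>Evolution of the weights along a run\<close>

lemma wt_update:
  "wt (osc_update \<theta> S st i T) s =
    (if s \<in> sets_of S i then \<theta> ^ osc_exponent \<theta> S st i * wt st s else wt st s)"
  by (simp add: osc_update_def)

lemma wt_update_ge:
  assumes "wt st s \<ge> 0"
  shows "wt st s \<le> wt (osc_update \<theta> S st i T) s"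
proof -
  have "1 \<le> \<theta> ^ osc_exponent \<theta> S st i"
    using theta by simp
  then show ?thesis
    using assms mult_right_mono[of 1 _ "wt st s"] by (simp add: wt_update)
qed

text \<open>Weights never decrease, and a set is rescaled only as a summand of an element weight
  that ends at most \<open>\<theta>\<close>. The lower bound also keeps weights positive, as
  \<open>osc_exponent_bounds\<close> requires.\<close>

lemma run_wt:
  assumes "osc_run \<theta> I S \<sigma> st" and "s \<in> S"
  shows "1 / (\<theta> * card S) \<le> wt st s \<and> wt st s \<le> \<theta>"
  using assms
proof (induction arbitrary: s rule: osc_run.induct)
  case start
  have "1 / (\<theta> * card S) \<le> 1"
    using theta card_S_pos mult_mono[of 1 \<theta> 1 "real (card S)"] by simp
  then show ?case
    using theta by (simp add: osc_init_def)
next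
  case (arrive \<sigma> st i st')
  from arrive.hyps(3) show ?case
  proof cases
    case skip
    then show ?thesis
      using arrive by simp
  next
    case (augment T)
    have pos: "wt st s > 0" if "s \<in> S" for s
    proof -
      have "0 < 1 / (\<theta> * card S)"
        using theta card_S_pos by simp
      then show ?thesis
        using arrive.IH[OF that] by linarith
    qed
    have "wt st' s \<le> \<theta>"
    proof (cases "s \<in> sets_of S i")
      case True
      have "wt st s \<le> elem_wt S st i"
        unfolding elem_wt_def
        by (rule member_le_sum[OF True])
          (use pos finite_sets_of in \<open>auto simp: sets_of_def less_imp_le\<close>)
      then have "\<theta> ^ osc_exponent \<theta> S st i * wt st s
          \<le> \<theta> ^ osc_exponent \<theta> S st i * elem_wt S st i"
        using theta by (intro mult_left_mono) auto
      also have "\<dots> \<le> \<theta>"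
        using osc_exponent_bounds(3) elem_wt_pos[OF \<open>i \<in> I\<close> pos] augment by blast
      finally show ?thesis
        using True augment by (simp add: wt_update)
    next
      case False
      then show ?thesis
        using arrive augment by (simp add: wt_update)
    qed
    moreover have "1 / (\<theta> * card S) \<le> wt st' s"
      using arrive.IH[OF arrive.prems] pos[OF arrive.prems] wt_update_ge[of st s i T] augment
      by (simp add: less_imp_le)
    ultimately show ?thesis
      by simp
  qed
qed

lemma run_wt_pos:
  assumes "osc_run \<theta> I S \<sigma> st" and "s \<in> S"
  shows "wt st s > 0"
proof -
  have "0 < 1 / (\<theta> * card S)"
    using theta card_S_pos by simp
  then show ?thesis
    using run_wt[OF assms] by linarith
qed

section \<open>Selected sets and the competitive ratio\<close>

lemma run_sel_subset:
  assumes "osc_run \<theta> I S \<sigma> st"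
  shows "sel st \<subseteq> S"
  using assms
proof (induction rule: osc_run.induct)
  case (arrive \<sigma> st i st')
  from arrive.hyps(3) arrive.IH show ?case
    by cases (auto simp: osc_update_def osc_admissible_def sets_of_def)
qed (simp add: osc_init_def)

text \<open>Amortization against a fixed cover \<open>C\<close>: the logarithm is the total exponent
  applied to \<open>s\<close> so far. It starts at 0, and an augmentation for \<open>i\<close>
  raises it by at least 1 for every set of \<open>C\<close> containing \<open>i\<close>, of which
  there is at least one.\<close>

lemma run_card_sel_le:
  assumes "osc_run \<theta> I S \<sigma> st" and "C \<subseteq> S" and "set \<sigma> \<subseteq> \<Union>C"
  shows "real (card (sel st)) \<le>
    2 * \<theta> * log 2 (card I) * (\<Sum>s\<in>C. log \<theta> (wt st s * (\<theta> * card S)))"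
  using assms
proof (induction rule: osc_run.induct)
  case start
  show ?case
    using theta card_S_pos by (simp add: osc_init_def)
next
  case (arrive \<sigma> st i st')
  have IH: "real (card (sel st)) \<le>
      2 * \<theta> * log 2 (card I) * (\<Sum>s\<in>C. log \<theta> (wt st s * (\<theta> * card S)))"
    using arrive by simp
  from arrive.hyps(3) show ?case
  proof cases
    case skip
    then show ?thesis
      using IH by simp
  next
    case (augment T)
    let ?k = "osc_exponent \<theta> S st i"
    have pos: "wt st s > 0" if "s \<in> S" for s
      using run_wt_pos[OF arrive.hyps(1) that] .
    have k: "?k \<ge> 1"
      using osc_exponent_bounds(1) elem_wt_pos[OF \<open>i \<in> I\<close> pos] augment by blast
    obtain c where c: "c \<in> C" "i \<in> c"
      using arrive.prems(2) by auto
    have finC: "finite C"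
      using arrive.prems(1) finite_S finite_subset by blast
    have log_update: "log \<theta> (wt st' s * (\<theta> * card S)) =
        log \<theta> (wt st s * (\<theta> * card S)) + (if i \<in> s then real ?k else 0)" if "s \<in> C" for s
    proof (cases "i \<in> s")
      case True
      have s: "s \<in> S"
        using that arrive.prems by auto
      then have "wt st' s * (\<theta> * card S) = \<theta> ^ ?k * (wt st s * (\<theta> * card S))"
        using True augment by (simp add: wt_update sets_of_def)
      moreover have "wt st s * (\<theta> * card S) > 0"
        using pos[OF s] theta card_S_pos by simp
      ultimately have "log \<theta> (wt st' s * (\<theta> * card S)) =
          log \<theta> (\<theta> ^ ?k) + log \<theta> (wt st s * (\<theta> * card S))"
        using theta by (simp only:) (intro log_mult_pos, auto)
      then show ?thesis
        using True theta by simp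
    next
      case False
      then show ?thesis
        using augment by (simp add: wt_update sets_of_def)
    qed
    have "1 \<le> (\<Sum>s\<in>C. if i \<in> s then real ?k else 0)"
    proof -
      have "1 \<le> (if i \<in> c then real ?k else 0)"
        using c k by simp
      also have "\<dots> \<le> (\<Sum>s\<in>C. if i \<in> s then real ?k else 0)"
        by (rule member_le_sum) (use c finC in auto)
      finally show ?thesis .
    qed
    then have sum_ge: "(\<Sum>s\<in>C. log \<theta> (wt st s * (\<theta> * card S))) + 1
        \<le> (\<Sum>s\<in>C. log \<theta> (wt st' s * (\<theta> * card S)))"
      by (simp add: log_update sum.distrib)
    have T: "real (card T) \<le> 2 * \<theta> * log 2 (card I)"
      using augment by (simp add: osc_admissible_def)
    have "card (sel st') \<le> card (sel st) + card T"
      using augment by (simp add: osc_update_def card_Un_le)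
    then have "real (card (sel st')) \<le> real (card (sel st)) + real (card T)"
      by linarith
    also have "\<dots> \<le> 2 * \<theta> * log 2 (card I) *
        ((\<Sum>s\<in>C. log \<theta> (wt st s * (\<theta> * card S))) + 1)"
      using IH T by (simp add: algebra_simps)
    also have "\<dots> \<le> 2 * \<theta> * log 2 (card I) * (\<Sum>s\<in>C. log \<theta> (wt st' s * (\<theta> * card S)))"
      using sum_ge theta card_I by (intro mult_left_mono) auto
    finally show ?thesis .
  qed
qed

lemma run_set_subset:
  assumes "osc_run \<theta> I S \<sigma> st"
  shows "set \<sigma> \<subseteq> I"
  using assms by (induction rule: osc_run.induct) auto

text \<open>The charging bound is applied to an optimal cover. The 2 counts two factors
  \<open>\<theta>\<close>: one from the cap on the weights, one from the initial weight
  \<open>1 / (\<theta> * card S)\<close>.\<close>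

lemma competitive:
  "osc_competitive I S \<theta> (2 * \<theta> * log 2 (card I) * (2 + log 2 (card S) / log 2 \<theta>))"
  unfolding osc_competitive_def
proof (intro allI impI)
  fix \<sigma> and st :: "'a osc_state"
  assume run: "osc_run \<theta> I S \<sigma> st"
  obtain C where C: "C \<subseteq> S" "set \<sigma> \<subseteq> \<Union>C" "card C = opt_cover S (set \<sigma>)"
    using opt_cover_attained[OF finite_S] run_set_subset[OF run] Union_S by metis
  have "log \<theta> (wt st s * (\<theta> * card S)) \<le> 2 + log 2 (card S) / log 2 \<theta>" if "s \<in> C" for s
  proof -
    have s: "s \<in> S"
      using that C by auto
    have "log \<theta> (wt st s * (\<theta> * card S)) \<le> log \<theta> (\<theta> * (\<theta> * card S))"
      using theta card_S_pos run_wt[OF run s] run_wt_pos[OF run s] by simp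
    also have "\<dots> = 2 + log \<theta> (card S)"
      using theta card_S_pos by (simp add: log_mult)
    also have "log \<theta> (card S) = log 2 (card S) / log 2 \<theta>"
      using theta by (intro log_base_change) auto
    finally show ?thesis .
  qed
  then have "(\<Sum>s\<in>C. log \<theta> (wt st s * (\<theta> * card S))) \<le>
      card C * (2 + log 2 (card S) / log 2 \<theta>)"
    by (intro sum_bounded_above) auto
  then have "2 * \<theta> * log 2 (card I) * (\<Sum>s\<in>C. log \<theta> (wt st s * (\<theta> * card S))) \<le>
      2 * \<theta> * log 2 (card I) * (card C * (2 + log 2 (card S) / log 2 \<theta>))"
    using theta card_I by (intro mult_left_mono) auto
  then show "real (card (sel st)) \<le> 2 * \<theta> * log 2 (card I) *
      (2 + log 2 (card S) / log 2 \<theta>) * real (opt_cover S (set \<sigma>))"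
    using run_card_sel_le[OF run C(1,2)] C(3) by (simp add: algebra_simps)
qed

section \<open>Existence of an admissible selection\<close>

lemma covered_update: "covered (osc_update \<theta> S st i T) = covered st \<union> \<Union>T"
  by (auto simp: covered_def osc_update_def)

text \<open>Only sets containing both \<open>i\<close> and \<open>j\<close> contribute to the
  growth. In this form the growth is proportional to the chance that a draw covers \<open>j\<close>,
  and it vanishes if \<open>i\<close> and \<open>j\<close> share no set.\<close>

lemma elem_wt_update:
  "elem_wt S (osc_update \<theta> S st i T) j = elem_wt S st j +
    (\<theta> ^ osc_exponent \<theta> S st i - 1) * (\<Sum>s\<in>{s \<in> sets_of S i. j \<in> s}. wt st s)"
proof -
  have eq: "{s \<in> sets_of S i. j \<in> s} = {s \<in> sets_of S j. s \<in> sets_of S i}"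
    by (auto simp: sets_of_def)
  have "elem_wt S (osc_update \<theta> S st i T) j = (\<Sum>s\<in>sets_of S j. wt st s +
      (if s \<in> sets_of S i then (\<theta> ^ osc_exponent \<theta> S st i - 1) * wt st s else 0))"
    unfolding elem_wt_def by (rule sum.cong) (auto simp: wt_update algebra_simps)
  also have "\<dots> = elem_wt S st j + (\<Sum>s\<in>{s \<in> sets_of S j. s \<in> sets_of S i}.
      (\<theta> ^ osc_exponent \<theta> S st i - 1) * wt st s)"
    by (simp add: sum.distrib elem_wt_def sum.inter_filter finite_sets_of)
  finally show ?thesis
    by (simp add: eq sum_distrib_left)
qed

text \<open>The budget is at least 2, enough for one set per element other than \<open>i\<close>.
  Every element sharing a set with \<open>i\<close> gets covered, and all others keep their
  weight.\<close>

lemma admissible_exists_small: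
  assumes "card I \<le> 3" and "i \<in> I"
  shows "\<exists>T. osc_admissible \<theta> I S st i T"
proof -
  \<comment> \<open>An element sharing no set with \<open>i\<close> is assigned an arbitrary member
    of \<open>sets_of S i\<close>, so that \<open>f\<close> always lands there.\<close>
  have "\<forall>j. \<exists>s. s \<in> sets_of S i \<and> (j \<in> \<Union>(sets_of S i) \<longrightarrow> j \<in> s)"
    using sets_of_nonempty[OF assms(2)] by blast
  then obtain f where f: "\<And>j. f j \<in> sets_of S i"
      "\<And>j. j \<in> \<Union>(sets_of S i) \<Longrightarrow> j \<in> f j"
    by metis
  define T where "T = f ` (I - {i})"
  have card_Diff: "card (I - {i}) = card I - 1"
    using assms(2) by simp
  have T_sub: "T \<subseteq> sets_of S i"
    using f by (auto simp: T_def)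
  \<comment> \<open>Every member of \<open>T\<close> contains \<open>i\<close>, so nonemptiness of
    \<open>T\<close> suffices to cover \<open>i\<close>.\<close>
  have "I - {i} \<noteq> {}"
    using card_Diff card_I by (intro notI) simp
  then have "T \<noteq> {}"
    by (simp add: T_def)
  then have i_cov: "i \<in> \<Union>T"
    using T_sub by (auto simp: sets_of_def)
  have "card T \<le> card I - 1"
    using card_image_le[of "I - {i}" f] finite_I card_Diff by (simp add: T_def)
  then have "real (card T) \<le> 2"
    using assms(1) by simp
  moreover have "1 \<le> log 2 (real (card I))"
    using card_I by simp
  then have "2 \<le> 2 * \<theta> * log 2 (real (card I))"
    using theta mult_mono[of 1 \<theta> 1 "log 2 (real (card I))"] by simp
  moreover have "potential I S (osc_update \<theta> S st i T) \<le> potential I S st"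
  proof -
    have "elem_wt S (osc_update \<theta> S st i T) j = elem_wt S st j"
      if "j \<in> I - covered (osc_update \<theta> S st i T)" for j
    proof -
      have "j \<notin> \<Union>T" "j \<in> I"
        using that by (auto simp: covered_update)
      \<comment> \<open>As \<open>i\<close> is covered, \<open>j\<close> differs from
        \<open>i\<close> and \<open>f j\<close> lies in \<open>T\<close>; it would cover
        \<open>j\<close> if any set containing \<open>i\<close> did.\<close>
      then have "j \<notin> \<Union>(sets_of S i)"
        using f(2)[of j] i_cov by (auto simp: T_def)
      then have empty: "{s \<in> sets_of S i. j \<in> s} = {}"
        by auto
      show ?thesis
        unfolding elem_wt_update empty by simp
    qed
    then have "potential I S (osc_update \<theta> S st i T) =
        (\<Sum>j\<in>I - covered (osc_update \<theta> S st i T). real (card I) powr (2 * elem_wt S st j))"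
      by (simp add: potential_def)
    also have "\<dots> \<le> potential I S st"
      unfolding potential_def
      by (intro sum_mono2) (use finite_I in \<open>auto simp: covered_update\<close>)
    finally show ?thesis .
  qed
  ultimately have "osc_admissible \<theta> I S st i T"
    unfolding osc_admissible_def using T_sub i_cov by (auto simp: covered_update)
  then show ?thesis ..
qed

text \<open>With \<open>x\<close> the upper end, the interval has length
  \<open>x * (1 - ln 2)\<close>, at least \<open>x / 4\<close> and hence at least 1, so it contains
  the floor of \<open>x\<close>.\<close>

lemma draw_count_exists:
  assumes "card I \<ge> 4"
  obtains N :: nat where "N > 0" and "2 * \<theta> * ln (card I) \<le> N" and "N \<le> 2 * \<theta> * log 2 (card I)"
proof -
  define x where "x = 2 * \<theta> * log 2 (card I)"
  have "2 = log 2 (4::real)"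
    using log_nat_power[of 2 2 2] by simp
  also have "\<dots> \<le> log 2 (card I)"
    using assms by simp
  finally have "2 * 2 \<le> 2 * \<theta> * log 2 (card I)"
    using theta by (intro mult_mono) auto
  then have x: "x \<ge> 4"
    by (simp add: x_def)
  \<comment> \<open>The quadratic Taylor bound gives 1 + 3/4 + 9/32 > 2.\<close>
  have "2 \<le> exp (3 / 4 :: real)"
    using exp_lower_Taylor_quadratic[of "3 / 4 :: real"] by (simp add: power2_eq_square)
  then have ln2_le: "ln 2 \<le> (3 / 4 :: real)"
    by (simp add: ln_le_cancel_iff[of 2 "exp (3 / 4)", symmetric] del: ln_le_cancel_iff)
  have "2 * \<theta> * ln (card I) = x * ln 2"
    by (simp add: x_def log_def)
  also have "\<dots> \<le> x * (3 / 4)"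
    using x ln2_le by (intro mult_left_mono) auto
  finally have le: "2 * \<theta> * ln (card I) \<le> x - 1"
    using x by simp
  show thesis
  proof (rule that[of "nat \<lfloor>x\<rfloor>"])
    show "nat \<lfloor>x\<rfloor> > 0"
      using x by simp
    show "2 * \<theta> * ln (card I) \<le> nat \<lfloor>x\<rfloor>" "nat \<lfloor>x\<rfloor> \<le> 2 * \<theta> * log 2 (card I)"
      unfolding x_def[symmetric] using x le by linarith+
  qed
qed

lemma admissible_exists_large:
  assumes "card I \<ge> 4" and "i \<in> I" and "elem_wt S st i < 1" and pos: "\<And>s. s \<in> S \<Longrightarrow> wt st s > 0"
  shows "\<exists>T. osc_admissible \<theta> I S st i T"
proof -
  let ?n = "real (card I)"
  let ?up = "osc_update \<theta> S st i"
  \<comment> \<open>\<open>W\<close> normalizes the draw probabilities: \<open>u j / W\<close> is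
    the chance that one draw covers \<open>j\<close>, while \<open>g * u j\<close> is the growth of
    its weight.\<close>
  define W where "W = elem_wt S st i"
  define g where "g = \<theta> ^ osc_exponent \<theta> S st i - 1"
  define u where "u j = (\<Sum>s\<in>{s \<in> sets_of S i. j \<in> s}. wt st s)" for j
  have W: "W > 0"
    using elem_wt_pos[OF assms(2) pos] by (simp add: W_def)
  have g: "g \<ge> 0"
    using theta by (simp add: g_def)
  have gW: "g * W \<le> \<theta>"
    using osc_exponent_bounds(3)[of st i] W assms(3) by (simp add: g_def W_def left_diff_distrib)
  have update: "elem_wt S (?up T) j = elem_wt S st j + g * u j" for T j
    unfolding elem_wt_update by (simp add: g_def u_def)
  obtain N where N: "N > 0" "2 * \<theta> * ln ?n \<le> real N" "real N \<le> 2 * \<theta> * log 2 ?n"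
    using draw_count_exists[OF assms(1)] .
  have "sum (\<lambda>s. wt st s / W) (sets_of S i) = 1"
    using W by (simp add: sum_divide_distrib[symmetric] W_def elem_wt_def)
  moreover have "\<And>s. s \<in> sets_of S i \<Longrightarrow> wt st s / W \<ge> 0"
    using pos W by (simp add: sets_of_def less_imp_le)
  \<comment> \<open>The values passed to the sampling lemma are potential terms with updated
    weights; these do not depend on the choice of \<open>T\<close>.\<close>
  ultimately obtain T where T: "T \<subseteq> sets_of S i" "card T \<le> N" "T \<noteq> {}"
    and T_le: "(\<Sum>j\<in>(I - covered st) - \<Union>T. ?n powr (2 * (elem_wt S st j + g * u j))) \<le>
      (\<Sum>j\<in>I - covered st. ?n powr (2 * (elem_wt S st j + g * u j)) *
        (1 - (\<Sum>s\<in>{s\<in>sets_of S i. j \<in> s}. wt st s / W)) ^ N)"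
    using exists_selection_le_expectation[OF finite_sets_of, of i "\<lambda>s. wt st s / W"
        "I - covered st" N "\<lambda>j. ?n powr (2 * (elem_wt S st j + g * u j))"] finite_I N(1)
    by blast
  have u_le: "u j / W \<le> 1" and u_ge: "u j \<ge> 0" for j
  proof -
    have "u j \<le> W"
      unfolding u_def W_def elem_wt_def
      by (intro sum_mono2) (use finite_sets_of pos in \<open>auto simp: sets_of_def less_imp_le\<close>)
    then show "u j / W \<le> 1"
      using W by simp
    show "u j \<ge> 0"
      unfolding u_def by (intro sum_nonneg) (use pos in \<open>auto simp: sets_of_def less_imp_le\<close>)
  qed
  have decay: "?n powr (2 * (elem_wt S st j + g * u j)) *
      (1 - (\<Sum>s\<in>{s\<in>sets_of S i. j \<in> s}. wt st s / W)) ^ N \<le> ?n powr (2 * elem_wt S st j)" for j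
  proof -
    \<comment> \<open>\<open>u j / W \<le> 1\<close> makes the base nonnegative, so the bound
      \<open>1 - x \<le> exp (- x)\<close> can be raised to the power \<open>N\<close>.\<close>
    have "(1 - u j / W) ^ N \<le> exp (- (u j / W)) ^ N"
      using u_le[of j] exp_ge_add_one_self[of "- (u j / W)"] by (intro power_mono) auto
    also have "\<dots> = exp (- (u j / W * N))"
      by (simp add: exp_of_nat_mult[symmetric] mult.commute)
    also have "\<dots> \<le> exp (- (2 * (g * u j)) * ln ?n)"
    proof -
      \<comment> \<open>After multiplication by \<open>u j / W\<close> the factor \<open>W\<close>
        cancels, leaving exactly the growth \<open>g * u j\<close> in the exponent.\<close>
      have "2 * (g * W) * ln ?n \<le> 2 * \<theta> * ln ?n"
        using gW card_I by (intro mult_right_mono) auto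
      also note N(2)
      finally have "u j / W * (2 * (g * W) * ln ?n) \<le> u j / W * N"
        using u_ge W by (intro mult_left_mono) auto
      then show ?thesis
        using W by (simp add: algebra_simps)
    qed
    also have "\<dots> = ?n powr (- (2 * (g * u j)))"
      using card_I by (auto simp: powr_def)
    finally have "?n powr (2 * (elem_wt S st j + g * u j)) * (1 - u j / W) ^ N \<le>
        ?n powr (2 * (elem_wt S st j + g * u j)) * ?n powr (- (2 * (g * u j)))"
      by (intro mult_left_mono) auto
    also have "\<dots> = ?n powr (2 * elem_wt S st j)"
      by (simp add: powr_add[symmetric] algebra_simps)
    finally show ?thesis
      by (simp add: u_def sum_divide_distrib)
  qed
  have "I - covered (?up T) = (I - covered st) - \<Union>T"
    by (auto simp: covered_update)
  then have "potential I S (?up T) =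
      (\<Sum>j\<in>(I - covered st) - \<Union>T. ?n powr (2 * (elem_wt S st j + g * u j)))"
    by (simp add: potential_def update)
  also note T_le
  also have "(\<Sum>j\<in>I - covered st. ?n powr (2 * (elem_wt S st j + g * u j)) *
        (1 - (\<Sum>s\<in>{s\<in>sets_of S i. j \<in> s}. wt st s / W)) ^ N) \<le> potential I S st"
    unfolding potential_def by (intro sum_mono decay)
  finally have "potential I S (?up T) \<le> potential I S st" .
  moreover have "i \<in> \<Union>T"
    using T by (auto simp: sets_of_def)
  moreover have "real (card T) \<le> 2 * \<theta> * log 2 ?n"
    using T(2) N(3) by linarith
  ultimately have "osc_admissible \<theta> I S st i T"
    unfolding osc_admissible_def using T by (simp add: covered_update)
  then show ?thesis ..
qed

lemma never_stuck: "osc_never_stuck I S \<theta>"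
  unfolding osc_never_stuck_def
proof (intro allI impI)
  fix \<sigma> i and st :: "'a osc_state"
  assume *: "osc_run \<theta> I S \<sigma> st \<and> i \<in> I \<and> elem_wt S st i < 1"
  show "\<exists>T. osc_admissible \<theta> I S st i T"
  proof (cases "card I \<le> 3")
    case True
    then show ?thesis
      using admissible_exists_small * by blast
  next
    case False
    then show ?thesis
      using * run_wt_pos by (intro admissible_exists_large) auto
  qed
qed

section \<open>Bounds on the potential and coverage\<close>

lemma run_potential_le:
  assumes "osc_run \<theta> I S \<sigma> st"
  shows "potential I S st \<le> potential I S (osc_init \<theta> S)"
  using assms
proof (induction rule: osc_run.induct)
  case (arrive \<sigma> st i st')
  from arrive.hyps(3) arrive.IH show ?case
    by cases (auto simp: osc_admissible_def)
qed simp

text \<open>An augmentation leaves its element covered, hence some set selected. This handles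
  \<open>S = {I}\<close>, where the initial potential can equal \<open>n^2\<close> and gives no
  contradiction.\<close>

lemma run_sel_nonempty:
  assumes "osc_run \<theta> I S \<sigma> st"
  shows "st = osc_init \<theta> S \<or> sel st \<noteq> {}"
  using assms
proof (induction rule: osc_run.induct)
  case (arrive \<sigma> st i st')
  from arrive.hyps(3) arrive.IH show ?case
    by cases (auto simp: osc_admissible_def covered_def osc_update_def)
qed simp

lemma elem_wt_init: "elem_wt S (osc_init \<theta> S) j = card (sets_of S j) / (\<theta> * card S)"
  by (simp add: elem_wt_def osc_init_def)

lemma elem_wt_init_le: "elem_wt S (osc_init \<theta> S) j \<le> 1 / \<theta>"
proof -
  have "card (sets_of S j) \<le> card S"
    using finite_S by (intro card_mono) (auto simp: sets_of_def)
  then show ?thesis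
    using theta card_S_pos by (simp add: elem_wt_init field_simps)
qed

text \<open>Initial weights are at most 1/2, so each of the \<open>n\<close> terms is at most
  \<open>n\<close>. A set other than \<open>I\<close> misses some element, whose term is strictly
  smaller.\<close>

lemma potential_init_less:
  assumes "\<theta> \<ge> 2" and "S \<noteq> {I}"
  shows "potential I S (osc_init \<theta> S) < real (card I) ^ 2"
proof -
  let ?n = "real (card I)"
  let ?w = "elem_wt S (osc_init \<theta> S)"
  have half: "1 / \<theta> \<le> 1 / 2"
    using assms(1) by (simp add: field_simps)
  have "S \<noteq> {}"
    using card_S_pos by auto
  then obtain s where s: "s \<in> S" "s \<noteq> I"
    using assms(2) by blast
  then obtain j where j: "j \<in> I" "j \<notin> s"
    using S_subset by blast
  have "sets_of S j \<subset> S"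
    using s j by (auto simp: sets_of_def)
  then have "card (sets_of S j) < card S"
    using finite_S by (rule psubset_card_mono[rotated])
  then have "?w j < 1 / \<theta>"
    using theta card_S_pos by (simp add: elem_wt_init field_simps)
  then have "2 * ?w j < 1"
    using half by linarith
  then have less: "?n powr (2 * ?w j) < ?n powr 1"
    using card_I by (intro powr_less_mono) auto
  have le: "?n powr (2 * ?w k) \<le> ?n powr 1" for k
    using card_I half elem_wt_init_le[of k] by (intro powr_mono) auto
  have "potential I S (osc_init \<theta> S) = (\<Sum>k\<in>I. ?n powr (2 * ?w k))"
    by (simp add: potential_def covered_def osc_init_def)
  also have "\<dots> < (\<Sum>k\<in>I. ?n powr 1)"
    using finite_I le less j by (intro sum_strict_mono_ex1) auto
  also have "\<dots> = ?n ^ 2"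
    by (simp add: power2_eq_square)
  finally show ?thesis .
qed

lemma covered_if_elem_wt_ge_1:
  assumes "\<theta> \<ge> 2" and run: "osc_run \<theta> I S \<sigma> st" and "i \<in> I" and "elem_wt S st i \<ge> 1"
  shows "i \<in> covered st"
proof (rule ccontr)
  assume unc: "i \<notin> covered st"
  \<comment> \<open>All initial weights are below 1, so some set has been selected; if
    \<open>S = {I}\<close>, that set would cover \<open>i\<close>.\<close>
  have "1 / \<theta> < 1"
    using theta by simp
  then have "st \<noteq> osc_init \<theta> S"
    using assms(4) elem_wt_init_le[of i] by auto
  then have "sel st \<noteq> {}"
    using run_sel_nonempty[OF run] by blast
  then have "S \<noteq> {I}"
    using run_sel_subset[OF run] unc assms(3) by (auto simp: covered_def)
  then have "potential I S st < real (card I) ^ 2"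
    using run_potential_le[OF run] potential_init_less[OF assms(1)] by simp
  also have "real (card I) ^ 2 = real (card I) powr 2"
    using card_I by simp
  also have "\<dots> \<le> real (card I) powr (2 * elem_wt S st i)"
    using card_I assms(4) by (intro powr_mono) auto
  also have "\<dots> \<le> potential I S st"
    unfolding potential_def
    by (rule member_le_sum) (use finite_I unc assms(3) in auto)
  finally show False
    by simp
qed

lemma covers:
  assumes "\<theta> \<ge> 2"
  shows "osc_covers I S \<theta>"
  unfolding osc_covers_def
proof (intro allI impI)
  fix \<sigma> and st :: "'a osc_state"
  assume "osc_run \<theta> I S \<sigma> st"
  then show "set \<sigma> \<subseteq> covered st"
  proof (induction rule: osc_run.induct)
    case (arrive \<sigma> st i st')
    from arrive.hyps(3) show ?case
    proof cases
      case skip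
      then show ?thesis
        using arrive covered_if_elem_wt_ge_1[OF assms] by auto
    next
      case (augment T)
      then show ?thesis
        using arrive.IH by (auto simp: osc_admissible_def covered_update)
    qed
  qed simp
qed

end

section \<open>The degradation factor\<close>

theorem theorem4p1:
  fixes I :: "'a set" and S :: "'a set set" and n m :: nat and \<theta> DF :: real
  assumes "finite I" and "n = card I" and "n \<ge> 2"
    and "S \<subseteq> Pow I" and "\<Union> S = I" and "m = card S"
    and "\<theta> > 1"
    and "DF = \<theta> * ((2 * log 2 \<theta> + log 2 m) / (2 * log 2 \<theta> * (2 + log 2 m)))"
  shows "osc_degradation_factor I S 2 (4 * log 2 n * (2 + log 2 m)) \<theta> DF
    \<and> DF * (4 * log 2 n * (2 + log 2 m)) = (2 * \<theta> * log 2 n) * (2 + log 2 m / log 2 \<theta>)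
    \<and> osc_competitive I S \<theta> ((2 * \<theta> * log 2 n) * (2 + log 2 m / log 2 \<theta>))
    \<and> osc_never_stuck I S \<theta>
    \<and> (\<theta> \<ge> 2 \<longrightarrow> osc_covers I S \<theta>)"
proof -
  interpret osc I S \<theta>
    using assms by unfold_locales auto
  \<comment> \<open>The baseline is the same ratio at parameter 2, where
    \<open>log 2 2 = 1\<close>.\<close>
  interpret two: osc I S 2
    using assms by unfold_locales auto
  have "log 2 \<theta> > 0"
    using assms by simp
  moreover have "2 + log 2 m > 0"
    using card_S_pos assms by (simp add: add_pos_nonneg)
  ultimately have eq: "DF * (4 * log 2 n * (2 + log 2 m)) =
      (2 * \<theta> * log 2 n) * (2 + log 2 m / log 2 \<theta>)"
    unfolding assms(8) by (simp add: divide_simps)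
  have "osc_competitive I S 2 (4 * log 2 n * (2 + log 2 m))"
    using two.competitive assms by simp
  then show ?thesis
    using eq competitive never_stuck covers assms by (simp add: osc_degradation_factor_def)
qed

end
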